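(* Let $v$ be even, let $X$ be a set of $v$ points partitioned into two parts $X_1,X_2$ of size $n=v/2$, let $k\ge 4$ be even with $n\ge k$, and let $h=k/2$. Suppose that on $X_1$ there is a resolvable $(n,h,2)$ covering design with parallel classes $\mathcal{P}_1,\ldots,\mathcal{P}_p$ and on $X_2$ a resolvable $(n,h,2)$ covering design with parallel classes $\mathcal{R}_1,\ldots,\mathcal{R}_p$, where $p\le 5$. For $i=1,2$ let $(X_i,\mathcal{B}_i)$ be an $(n,k,4)$ covering design. Define $$\mathcal{B}=\mathcal{B}_1\cup\mathcal{B}_2\cup\bigcup_{i=1}^p\mathcal{P}_i\mathcal{R}_i.$$ Then $(X,\mathcal{B})$ is a $(v,k,4,6)$ cover.
   Context: A $(v,k,t,m)$ cover is a pair $(X,\mathcal{B})$ with $|X|=v$ and $\mathcal{B}$ a collection of $k$-subsets of $X$ such that every $m$-subset of $X$ meets some block in at least $t$ points; a $(v,k,t)$ covering design is a $(v,k,t,t)$ cover (every $t$-subset lies in some block). A $(v,k,t)$ covering design is resolvable if its blocks can be partitioned into parallel classes, each of which is a partition of the point set. For collections $\mathcal{A},\mathcal{B}$, $\mathcal{A}\mathcal{B}=\{A\cup B: A\in\mathcal{A},B\in\mathcal{B}\}$. *)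

theory Defs
  imports Main "HOL-Library.Multiset" "HOL-Library.Disjoint_Sets"
begin

(* Block collections are multisets, so repeated blocks are allowed; a simple
   design given as a set of blocks is covered via mset_set. *)

definition cover ::
  "nat \<Rightarrow> nat \<Rightarrow> nat \<Rightarrow> nat \<Rightarrow> 'a set \<Rightarrow> 'a set multiset \<Rightarrow> bool" where
  "cover v k t m X \<B> \<longleftrightarrow>
     finite X \<and> card X = v \<and>
     (\<forall>B \<in># \<B>. B \<subseteq> X \<and> card B = k) \<and>
     (\<forall>M. M \<subseteq> X \<and> card M = m \<longrightarrow> (\<exists>B \<in># \<B>. t \<le> card (B \<inter> M)))"

definition covering_design ::
  "nat \<Rightarrow> nat \<Rightarrow> nat \<Rightarrow> 'a set \<Rightarrow> 'a set multiset \<Rightarrow> bool" where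
  "covering_design v k t X \<B> \<longleftrightarrow> cover v k t t X \<B>"

(* The multiset sum says that the blocks, counted with multiplicity, are
   partitioned into the classes P 1, ..., P p. A single class is a partition of
   the points and hence has no repeated block, but distinct classes may share
   blocks. *)

definition resolution ::
  "'a set \<Rightarrow> 'a set multiset \<Rightarrow> nat \<Rightarrow> (nat \<Rightarrow> 'a set set) \<Rightarrow> bool" where
  "resolution X \<B> p P \<longleftrightarrow>
     (\<forall>i \<in> {1..p}. partition_on X (P i)) \<and> \<B> = (\<Sum>i \<in> {1..p}. mset_set (P i))"

definition block_product :: "'a set set \<Rightarrow> 'a set set \<Rightarrow> 'a set set" where
  "block_product \<A> \<B> = {A \<union> B | A B. A \<in> \<A> \<and> B \<in> \<B>}"

end

(* A 6-set M with at least four points in one part is handled by the covering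
   design on that part. Otherwise M splits as two triples. If a class block
   contains one triple entirely, then it is joined with any block of the parallel
   class of the other side that meets the other triple, giving 3 + 1 points. If not, the
   three pairs of each triple are covered in three different classes, and since
   3 + 3 > 5 >= p, some index covers a pair on both sides, giving 2 + 2 points. *)

theory Submission
  imports Defs
begin

lemma finite_block_product:
  assumes "finite \<A>" and "finite \<B>"
  shows "finite (block_product \<A> \<B>)"
proof -
  have "block_product \<A> \<B> = (\<lambda>(A, B). A \<union> B) ` (\<A> \<times> \<B>)"
    by (auto simp: block_product_def)
  then show ?thesis
    using assms by simp
qed

lemma finite_resolution_class:
  assumes "finite X" and "resolution X \<B> p P" and "i \<in> {1..p}"
  shows "finite (P i)"
  using assms finite_elements unfolding resolution_def by blast

text \<open>Multiplicities vanish when only membership in the multiset sum is asked for. Finiteness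
  of \<open>X\<close> matters because \<open>mset_set\<close> is empty on an infinite set; it makes
  every class finite.\<close>

lemma mem_resolution_iff:
  assumes "finite X" and "resolution X \<B> p P"
  shows "A \<in># \<B> \<longleftrightarrow> (\<exists>i\<in>{1..p}. A \<in> P i)"
  using assms finite_resolution_class[OF assms]
  by (auto simp: resolution_def set_mset_sum)

text \<open>Shrinking \<open>M\<close> to a \<open>t\<close>-subset reduces to the defining
  property, and enlarging back to \<open>M\<close> can only increase the intersection. This serves
  parts of a 6-set that hold four, five or six points.\<close>

lemma covering_design_meets:
  assumes "covering_design n k t X \<B>" and "M \<subseteq> X" and "t \<le> card M"
  obtains B where "B \<in># \<B>" and "t \<le> card (B \<inter> M)"
proof -
  have "finite M"
    using assms finite_subset unfolding covering_design_def cover_def by blast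
  obtain T where T: "T \<subseteq> M" "card T = t"
    using assms(3) obtain_subset_with_card_n by metis
  then obtain B where B: "B \<in># \<B>" "t \<le> card (B \<inter> T)"
    using assms(1) subset_trans[OF T(1) assms(2)] unfolding covering_design_def cover_def by blast
  have "card (B \<inter> T) \<le> card (B \<inter> M)"
    using T \<open>finite M\<close> by (intro card_mono) auto
  with B show thesis
    using that by force
qed

lemma resolution_pair:
  assumes "covering_design n h 2 X \<B>" and "resolution X \<B> p P"
    and "x \<in> X" and "y \<in> X" and "x \<noteq> y"
  obtains i A where "i \<in> {1..p}" and "A \<in> P i" and "x \<in> A" and "y \<in> A"
proof -
  have fin: "finite X"
    using assms(1) by (simp add: covering_design_def cover_def)
  obtain A where A: "A \<in># \<B>" "2 \<le> card (A \<inter> {x, y})"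
    using covering_design_meets[OF assms(1), of "{x, y}"] assms(3-5) by auto
  \<comment> \<open>A subset of a two-element set with at least two elements is the whole
    set.\<close>
  have "A \<inter> {x, y} = {x, y}"
    using A(2) assms(5) by (intro card_seteq) auto
  then have "x \<in> A" "y \<in> A"
    by auto
  then show thesis
    using A(1) that mem_resolution_iff[OF fin assms(2)] by blast
qed

text \<open>Each of the three pairs in \<open>T\<close> lies in some class block, and any two of
  these pairs share a point. If two pairs use the same class, disjointness merges their blocks into
  one containing \<open>T\<close>; otherwise three distinct classes occur.\<close>

lemma resolution_triple:
  assumes "covering_design n h 2 X \<B>" and "resolution X \<B> p P"
    and "T \<subseteq> X" and "card T = 3"
  shows "(\<exists>i\<in>{1..p}. \<exists>A\<in>P i. T \<subseteq> A) \<or>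
    3 \<le> card {i \<in> {1..p}. \<exists>A\<in>P i. 2 \<le> card (A \<inter> T)}"
proof -
  obtain x y z where T: "T = {x, y, z}" and ne: "x \<noteq> y" "x \<noteq> z" "y \<noteq> z"
    using assms(4) by (auto simp: card_3_iff)
  have X: "x \<in> X" "y \<in> X" "z \<in> X"
    using assms(3) T by auto
  obtain a A where A: "a \<in> {1..p}" "A \<in> P a" "x \<in> A" "y \<in> A"
    using resolution_pair[OF assms(1,2) X(1,2) ne(1)] .
  obtain b B where B: "b \<in> {1..p}" "B \<in> P b" "x \<in> B" "z \<in> B"
    using resolution_pair[OF assms(1,2) X(1,3) ne(2)] .
  obtain c C where C: "c \<in> {1..p}" "C \<in> P c" "y \<in> C" "z \<in> C"
    using resolution_pair[OF assms(1,2) X(2,3) ne(3)] .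
  \<comment> \<open>Blocks of one parallel class are pairwise disjoint, so a common point identifies
    them.\<close>
  have same: "D = E" if "i \<in> {1..p}" "D \<in> P i" "E \<in> P i" "u \<in> D" "u \<in> E" for i D E u
    using assms(2) that disjointD[of "P i" D E]
    unfolding resolution_def partition_on_def by blast
  show ?thesis
  proof (cases "a = b \<or> a = c \<or> b = c")
    case True
    then have "\<exists>i\<in>{1..p}. \<exists>A\<in>P i. T \<subseteq> A"
      using A B C same T by blast
    then show ?thesis ..
  next
    case False
    have two: "2 \<le> card (D \<inter> T)" if "u \<in> D" "w \<in> D" "u \<in> T" "w \<in> T" "u \<noteq> w" for D u w
    proof -
      have "card {u, w} \<le> card (D \<inter> T)"
        using that T by (intro card_mono) auto
      then show ?thesis
        using that by simp
    qed
    have "{a, b, c} \<subseteq> {i \<in> {1..p}. \<exists>A\<in>P i. 2 \<le> card (A \<inter> T)}"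
      using A B C T ne two[of x A y] two[of x B z] two[of y C z] by blast
    then have "card {a, b, c} \<le> card {i \<in> {1..p}. \<exists>A\<in>P i. 2 \<le> card (A \<inter> T)}"
      by (intro card_mono) auto
    then show ?thesis
      using False by simp
  qed
qed

lemma partition_on_meets:
  assumes "partition_on X \<A>" and "finite T" and "T \<subseteq> X" and "T \<noteq> {}"
  obtains A where "A \<in> \<A>" and "1 \<le> card (A \<inter> T)"
proof -
  obtain x where x: "x \<in> T"
    using assms(4) by blast
  then obtain A where "A \<in> \<A>" "x \<in> A"
    using assms(1,3) unfolding partition_on_def by blast
  then show thesis
    using x assms(2) that by (auto simp: Suc_le_eq card_gt_0_iff)
qed

text \<open>The same index \<open>i\<close> must serve both sides, since only blocks of equally
  indexed classes are joined. The sum of the two counts becomes the size of one intersection once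
  the parts are known to be disjoint.\<close>

lemma resolution_triples_meet:
  assumes "covering_design n1 h1 2 X1 C1" and "resolution X1 C1 p P"
    and "covering_design n2 h2 2 X2 C2" and "resolution X2 C2 p R"
    and "p \<le> 5"
    and "S \<subseteq> X1" and "card S = 3" and "T \<subseteq> X2" and "card T = 3"
  obtains i A B where "i \<in> {1..p}" and "A \<in> P i" and "B \<in> R i"
    and "4 \<le> card (A \<inter> S) + card (B \<inter> T)"
proof -
  \<comment> \<open>Infinite sets and the empty set both have \<open>card\<close> equal to 0, so
    cardinality 3 excludes them.\<close>
  have fin: "finite S" "finite T" and ne: "S \<noteq> {}" "T \<noteq> {}"
    using assms(7,9) by (auto intro: card_ge_0_finite)
  have part: "partition_on X1 (P i)" "partition_on X2 (R i)" if "i \<in> {1..p}" for i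
    using assms(2,4) that by (auto simp: resolution_def)
  let ?I = "{i \<in> {1..p}. \<exists>A\<in>P i. 2 \<le> card (A \<inter> S)}"
  let ?J = "{i \<in> {1..p}. \<exists>B\<in>R i. 2 \<le> card (B \<inter> T)}"
  consider (S) i A where "i \<in> {1..p}" "A \<in> P i" "S \<subseteq> A"
    | (T) i B where "i \<in> {1..p}" "B \<in> R i" "T \<subseteq> B"
    | (pairs) "3 \<le> card ?I" "3 \<le> card ?J"
    using resolution_triple[OF assms(1,2,6,7)] resolution_triple[OF assms(3,4,8,9)] by blast
  then show thesis
  proof cases
    case S
    obtain B where B: "B \<in> R i" "1 \<le> card (B \<inter> T)"
      using partition_on_meets[OF part(2)[OF S(1)] fin(2) assms(8) ne(2)] .
    have "A \<inter> S = S"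
      using S(3) by blast
    then show thesis
      using that[OF S(1,2) B(1)] B(2) assms(7) by simp
  next
    case T
    obtain A where A: "A \<in> P i" "1 \<le> card (A \<inter> S)"
      using partition_on_meets[OF part(1)[OF T(1)] fin(1) assms(6) ne(1)] .
    have "B \<inter> T = T"
      using T(3) by blast
    then show thesis
      using that[OF T(1) A(1) T(2)] A(2) assms(9) by simp
  next
    case pairs
    \<comment> \<open>Pigeonhole: disjoint \<open>?I\<close> and \<open>?J\<close> would give at
      least 6 indices among at most 5.\<close>
    have "card (?I \<union> ?J) \<le> card {1..p}"
      by (intro card_mono) auto
    then have "?I \<inter> ?J \<noteq> {}"
      using pairs assms(5) card_Un_disjoint[of ?I ?J] by force
    then obtain i A B where "i \<in> {1..p}" "A \<in> P i" "B \<in> R i"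
      "2 \<le> card (A \<inter> S)" "2 \<le> card (B \<inter> T)"
      by blast
    then show thesis
      using that[of i A B] by linarith
  qed
qed

theorem theorem16:
  fixes v k n h p :: nat
    and X X1 X2 :: "'a set"
    and P R :: "nat \<Rightarrow> 'a set set"
    and C1 C2 B1 B2 \<B> :: "'a set multiset"
  assumes "even v"
    and "finite X" and "card X = v"
    and "X = X1 \<union> X2" and "X1 \<inter> X2 = {}"
    and "n = v div 2" and "card X1 = n" and "card X2 = n"
    and "even k" and "k \<ge> 4" and "n \<ge> k"
    and "h = k div 2"
    and "covering_design n h 2 X1 C1" and "resolution X1 C1 p P"
    and "covering_design n h 2 X2 C2" and "resolution X2 C2 p R"
    and "p \<le> 5"
    and "covering_design n k 4 X1 B1"
    and "covering_design n k 4 X2 B2"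
    and "\<B> = B1 + B2 + (\<Sum>i \<in> {1..p}. mset_set (block_product (P i) (R i)))"
  shows "cover v k 4 6 X \<B>"
proof -
  have fin: "finite X1" "finite X2"
    using assms(2,4) by auto
  note classes1 = mem_resolution_iff[OF fin(1) assms(14)]
  note classes2 = mem_resolution_iff[OF fin(2) assms(16)]
  have mem: "D \<in># \<B> \<longleftrightarrow> D \<in># B1 \<or> D \<in># B2 \<or>
      (\<exists>i\<in>{1..p}. \<exists>A\<in>P i. \<exists>B\<in>R i. D = A \<union> B)" for D
  proof -
    \<comment> \<open>Finiteness keeps \<open>mset_set\<close> from collapsing to the empty
      multiset.\<close>
    have "finite (block_product (P i) (R i))" if "i \<in> {1..p}" for i
      using finite_block_product finite_resolution_class[OF fin(1) assms(14) that]
        finite_resolution_class[OF fin(2) assms(16) that] .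
    then have "D \<in># \<B> \<longleftrightarrow> D \<in># B1 \<or> D \<in># B2 \<or>
        (\<exists>i\<in>{1..p}. D \<in> block_product (P i) (R i))"
      by (simp add: assms(20) set_mset_sum)
    then show ?thesis
      unfolding block_product_def by blast
  qed
  have sub1: "A \<subseteq> X1" and card1: "card A = h" if "i \<in> {1..p}" "A \<in> P i" for i A
    using that assms(13) classes1 unfolding covering_design_def cover_def by blast+
  have sub2: "B \<subseteq> X2" and card2: "card B = h" if "i \<in> {1..p}" "B \<in> R i" for i B
    using that assms(15) classes2 unfolding covering_design_def cover_def by blast+
  have "D \<subseteq> X \<and> card D = k" if "D \<in># \<B>" for D
  proof -
    consider "D \<in># B1" | "D \<in># B2"
      | i A B where "i \<in> {1..p}" "A \<in> P i" "B \<in> R i" "D = A \<union> B"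
      using \<open>D \<in># \<B>\<close> mem by blast
    then show ?thesis
    proof cases
      case 1
      then show ?thesis
        using assms(4,18) unfolding covering_design_def cover_def by blast
    next
      case 2
      then show ?thesis
        using assms(4,19) unfolding covering_design_def cover_def by blast
    next
      case (3 i A B)
      have AB: "A \<subseteq> X1" "B \<subseteq> X2"
        using sub1[OF 3(1,2)] sub2[OF 3(1,3)] .
      then have "finite A" "finite B" "A \<inter> B = {}"
        using fin finite_subset assms(5) by blast+
      \<comment> \<open>The two halves lie in disjoint parts, so their sizes add; evenness of
        \<open>k\<close> then turns \<open>h + h\<close> into \<open>k\<close>.\<close>
      then have "card D = h + h"
        using 3 card1 card2 by (simp add: card_Un_disjoint)
      then show ?thesis
        using AB 3(4) assms(4,9,12) by auto
    qed
  qed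
  moreover have "\<exists>D\<in>#\<B>. 4 \<le> card (D \<inter> M)" if M: "M \<subseteq> X" "card M = 6" for M
  proof -
    let ?S = "M \<inter> X1" and ?T = "M \<inter> X2"
    have finM: "finite M"
      using M(1) assms(2) finite_subset by blast
    have "M = ?S \<union> ?T" "?S \<inter> ?T = {}"
      using M(1) assms(4,5) by auto
    then have sum: "card ?S + card ?T = 6"
      using card_Un_disjoint[of ?S ?T] finM M(2) by simp
    have lift: "4 \<le> card (D \<inter> M)" if "4 \<le> card (D \<inter> (M \<inter> Y))" for D Y
      using that card_mono[of "D \<inter> M" "D \<inter> (M \<inter> Y)"] finM by fastforce
    \<comment> \<open>Two numbers with sum 6 that are both below 4 must both be 3.\<close>
    consider "4 \<le> card ?S" | "4 \<le> card ?T" | "card ?S = 3" "card ?T = 3"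
      using sum by linarith
    then show ?thesis
    proof cases
      case 1
      then obtain D where "D \<in># B1" "4 \<le> card (D \<inter> ?S)"
        using covering_design_meets[OF assms(18)] by (metis inf_le2)
      then show ?thesis
        using mem lift by blast
    next
      case 2
      then obtain D where "D \<in># B2" "4 \<le> card (D \<inter> ?T)"
        using covering_design_meets[OF assms(19)] by (metis inf_le2)
      then show ?thesis
        using mem lift by blast
    next
      case 3
      obtain i A B where i: "i \<in> {1..p}" "A \<in> P i" "B \<in> R i"
        and le: "4 \<le> card (A \<inter> ?S) + card (B \<inter> ?T)"
        using resolution_triples_meet[OF assms(13-17) _ 3(1) _ 3(2)] by blast
      \<comment> \<open>The two traces lie in \<open>X1\<close> and \<open>X2\<close> respectively,
        so no point of \<open>M\<close> is counted twice.\<close>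
      have "card (A \<inter> ?S) + card (B \<inter> ?T) = card ((A \<inter> ?S) \<union> (B \<inter> ?T))"
        using finM assms(5) by (intro card_Un_disjoint[symmetric]) auto
      also have "\<dots> \<le> card ((A \<union> B) \<inter> M)"
        using finM by (intro card_mono) auto
      finally show ?thesis
        using i le mem[of "A \<union> B"] by force
    qed
  qed
  ultimately show ?thesis
    using assms(2,3) unfolding cover_def by blast
qed

end
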